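(* Let $\|\cdot\|$ be a norm on $\mathbb{R}^d$ (the source norm), with dual norm $\|\cdot\|_\star$, and let $\|\cdot\|^{\mathrm{sn}}_{\star(k)}$ be the associated generalized $k$-support norms. - If $\|\cdot\|$ is orthant-monotonic, then the nonincreasing sequence $(\|\cdot\|^{\mathrm{sn}}_{\star(j)})_{j\in\{1,\dots,d\}}$ is decreasingly graded with respect to the $\ell_0$ pseudonorm, that is, $$\ell_0(y)\le l \ \Longrightarrow\ \|y\|^{\mathrm{sn}}_{\star(l)}=\|y\|^{\mathrm{sn}}_{\star(d)}\qquad \forall y\in\mathbb{R}^d,\ \forall l\in\{0,1,\dots,d\}.$$ - If $\|\cdot\|$ is orthant-monotonic and if the normed space $(\mathbb{R}^d,\|\cdot\|_\star)$ is strictly convex, then the nonincreasing sequence $(\|\cdot\|^{\mathrm{sn}}_{\star(j)})_{j\in\{1,\dots,d\}}$ is strictly decreasingly graded with respect to the $\ell_0$ pseudonorm, that is, $$\ell_0(y)\le l \iff \|y\|^{\mathrm{sn}}_{\star(l)}=\|y\|^{\mathrm{sn}}_{\star(d)}\qquad \forall y\in\mathbb{R}^d,\ \forall l\in\{0,1,\dots,d\}.$$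
   Context: $d\ge 1$ is an integer and $\mathbb{R}^d$ carries the standard scalar product $\langle\cdot,\cdot\rangle$. $\ell_0(x)$ is the number of nonzero components of $x\in\mathbb{R}^d$. The dual norm of a norm $\|\cdot\|$ is $\|y\|_\star=\sup_{\|x\|\le 1}\langle x,y\rangle$. For $K\subset\{1,\dots,d\}$, $x_K$ is the vector that coincides with $x$ on $K$ and is zero outside $K$. For $k\in\{1,\dots,d\}$, the generalized top-$k$ norm is $\|x\|^{\mathrm{tn}}_{(k)}=\sup\{\|x_K\| : K\subset\{1,\dots,d\},\ |K|\le k\}$, and the generalized $k$-support norm $\|\cdot\|^{\mathrm{sn}}_{\star(k)}$ is its dual norm. For $k=0$, convention: $\|0\|^{\mathrm{sn}}_{\star(0)}=0$ and $\|y\|^{\mathrm{sn}}_{\star(0)}=+\infty$ for $y\ne 0$. A norm $\|\cdot\|$ is orthant-monotonic if, for all $x,x'\in\mathbb{R}^d$, ($|x_i|\le|x_i'|$ and $x_ix_i'\ge 0$ for all $i$) implies $\|x\|\le\|x'\|$. A normed space is strictly convex if every point of its unit sphere is an extreme point of its unit ball. A sequence of norms $(N_k)_{k\in\{1,\dots,d\}}$ on $\mathbb{R}^d$ is decreasingly graded (resp. strictly decreasingly graded) with respect to $\ell_0$ if, for any $y\in\mathbb{R}^d$, the sequence $k\mapsto N_k(y)$ is nonincreasing and, for any $l\in\{1,\dots,d\}$, $\ell_0(y)\le l$ implies (resp. is equivalent to) $N_l(y)=N_d(y)$. *)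

theory Defs
  imports "HOL-Analysis.Analysis"
begin

text \<open>
  The space is \<^typ>\<open>real ^ 'n\<close>, with \<open>d = CARD('n)\<close>, which is at least 1 for
  every finite type. The source norm is an arbitrary norm, hence a function
  \<open>N :: real ^ 'n \<Rightarrow> real\<close>; the overloaded constant \<^const>\<open>norm\<close> is the Euclidean norm.
\<close>

definition is_norm :: "('a::real_vector \<Rightarrow> real) \<Rightarrow> bool" where
  "is_norm N \<longleftrightarrow>
     (\<forall>x. 0 \<le> N x) \<and>
     (\<forall>x. N x = 0 \<longleftrightarrow> x = 0) \<and>
     (\<forall>c x. N (c *\<^sub>R x) = \<bar>c\<bar> * N x) \<and>
     (\<forall>x y. N (x + y) \<le> N x + N y)"

definition l0 :: "real ^ 'n \<Rightarrow> nat" where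
  "l0 x = card {i. x $ i \<noteq> 0}"

text \<open>For a norm \<open>N\<close>, the supremum below is over a nonempty set that is bounded above,
  so that the conditionally complete supremum of the reals is the intended one.\<close>

definition dual_norm :: "('a::real_inner \<Rightarrow> real) \<Rightarrow> 'a \<Rightarrow> real" where
  "dual_norm N y = (SUP x\<in>{x. N x \<le> 1}. x \<bullet> y)"

definition restrict_vec :: "real ^ 'n \<Rightarrow> 'n set \<Rightarrow> real ^ 'n" where
  "restrict_vec x K = (\<chi> i. if i \<in> K then x $ i else 0)"

definition top_norm :: "(real ^ 'n \<Rightarrow> real) \<Rightarrow> nat \<Rightarrow> real ^ 'n \<Rightarrow> real" where
  "top_norm N k x = (SUP K\<in>{K. card K \<le> k}. N (restrict_vec x K))"

text \<open>The generalized \<open>k\<close>-support norm for \<open>k \<in> {1..d}\<close>. For \<open>k = 0\<close> the convention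
  involves the value \<open>+\<infinity>\<close>, so the extension to \<open>k \<in> {0..d}\<close> takes values in \<^typ>\<open>ereal\<close>.\<close>

definition support_norm :: "(real ^ 'n \<Rightarrow> real) \<Rightarrow> nat \<Rightarrow> real ^ 'n \<Rightarrow> real" where
  "support_norm N k = dual_norm (top_norm N k)"

definition ext_support_norm :: "(real ^ 'n \<Rightarrow> real) \<Rightarrow> nat \<Rightarrow> real ^ 'n \<Rightarrow> ereal" where
  "ext_support_norm N k y =
     (if k = 0 then (if y = 0 then 0 else \<infinity>) else ereal (support_norm N k y))"

definition orthant_monotonic :: "(real ^ 'n \<Rightarrow> real) \<Rightarrow> bool" where
  "orthant_monotonic N \<longleftrightarrow>
     (\<forall>x x'. (\<forall>i. \<bar>x $ i\<bar> \<le> \<bar>x' $ i\<bar> \<and> x $ i * x' $ i \<ge> 0) \<longrightarrow> N x \<le> N x')"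

definition strictly_convex_norm :: "('a::real_vector \<Rightarrow> real) \<Rightarrow> bool" where
  "strictly_convex_norm N \<longleftrightarrow>
     (\<forall>x. N x = 1 \<longrightarrow> x extreme_point_of {z. N z \<le> 1})"

text \<open>Sequences of norms are indexed by \<open>{1..d}\<close>; values at other indices are irrelevant.\<close>

definition nonincreasing_norms :: "(nat \<Rightarrow> real ^ 'n \<Rightarrow> real) \<Rightarrow> bool" where
  "nonincreasing_norms S \<longleftrightarrow>
     (\<forall>k\<in>{1..CARD('n)}. is_norm (S k)) \<and>
     (\<forall>y. antimono_on {1..CARD('n)} (\<lambda>k. S k y))"

definition decreasingly_graded :: "(nat \<Rightarrow> real ^ 'n \<Rightarrow> real) \<Rightarrow> bool" where
  "decreasingly_graded S \<longleftrightarrow>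
     nonincreasing_norms S \<and>
     (\<forall>y. \<forall>l\<in>{1..CARD('n)}. l0 y \<le> l \<longrightarrow> S l y = S CARD('n) y)"

definition strictly_decreasingly_graded :: "(nat \<Rightarrow> real ^ 'n \<Rightarrow> real) \<Rightarrow> bool" where
  "strictly_decreasingly_graded S \<longleftrightarrow>
     nonincreasing_norms S \<and>
     (\<forall>y. \<forall>l\<in>{1..CARD('n)}. l0 y \<le> l \<longleftrightarrow> S l y = S CARD('n) y)"

end

theory Submission
  imports Defs
begin

text \<open>
  Write \<open>N\<^sub>\<star>\<close> for the dual norm. Orthant-monotonicity enters only through the inequality
  \<open>N (x\<^sub>K) \<le> N x\<close>, which says that the coordinate projections are contractions. It gives that the
  top-\<open>d\<close> norm is \<open>N\<close>, so the \<open>d\<close>-support norm is \<open>N\<^sub>\<star>\<close>; and, since the projections are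
  self-adjoint, it gives \<open>N\<^sub>\<star> (z\<^sub>K) \<le> N\<^sub>\<star> z\<close> as well.

  Top-\<open>k\<close> norms increase with \<open>k\<close>, hence support norms decrease and are never below \<open>N\<^sub>\<star>\<close>. If \<open>y\<close> is
  supported on \<open>K\<close> with \<open>card K \<le> l\<close>, then \<open>x \<bullet> y = x\<^sub>K \<bullet> y\<close>, so only \<open>N (x\<^sub>K)\<close>, which is at most the
  top-\<open>l\<close> norm of \<open>x\<close>, matters in the supremum that defines the \<open>l\<close>-support norm of \<open>y\<close>; this gives
  equality with \<open>N\<^sub>\<star> y\<close>.

  For the converse, a separation argument (lemma \<open>support_norm_ball_subset_hull\<close>) shows that the unit
  ball of the \<open>l\<close>-support norm lies in the convex hull of the projections \<open>z\<^sub>K\<close> of points \<open>z\<close> of the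
  unit ball of \<open>N\<^sub>\<star>\<close>, with \<open>card K \<le> l\<close>. Those projections again lie in the unit ball of \<open>N\<^sub>\<star>\<close>. If
  both norms of \<open>y\<close> equal 1, then \<open>y\<close> is in that hull and, by strict convexity, is an extreme point of
  the unit ball of \<open>N\<^sub>\<star>\<close>. An extreme point of a convex hull is one of the generators, so \<open>y\<close> is some
  \<open>z\<^sub>K\<close> and has at most \<open>l\<close> nonzero components.
\<close>

section \<open>Norms on Euclidean spaces and their duals\<close>

lemma is_norm_nonneg: "is_norm N \<Longrightarrow> 0 \<le> N x"
  and is_norm_eq_0_iff: "is_norm N \<Longrightarrow> N x = 0 \<longleftrightarrow> x = 0"
  and is_norm_scaleR: "is_norm N \<Longrightarrow> N (c *\<^sub>R x) = \<bar>c\<bar> * N x"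
  and is_norm_triangle: "is_norm N \<Longrightarrow> N (x + y) \<le> N x + N y"
  by (auto simp: is_norm_def)

lemma is_norm_0: "is_norm N \<Longrightarrow> N 0 = 0"
  by (simp add: is_norm_eq_0_iff)

lemma is_norm_pos: "is_norm N \<Longrightarrow> x \<noteq> 0 \<Longrightarrow> 0 < N x"
  using is_norm_nonneg[of N x] is_norm_eq_0_iff[of N x] by linarith

lemma is_norm_normalize: "is_norm N \<Longrightarrow> x \<noteq> 0 \<Longrightarrow> N ((1 / N x) *\<^sub>R x) = 1"
  using is_norm_pos[of N x] by (simp add: is_norm_scaleR)

lemma is_norm_convex_on:
  assumes N: "is_norm N"
  shows "convex_on UNIV N"
proof (rule convex_onI)
  fix t x y assume t: "0 < (t::real)" "t < 1"
  have "N ((1 - t) *\<^sub>R x + t *\<^sub>R y) \<le> N ((1 - t) *\<^sub>R x) + N (t *\<^sub>R y)"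
    by (rule is_norm_triangle[OF N])
  also have "\<dots> = (1 - t) * N x + t * N y"
    using t by (simp add: is_norm_scaleR[OF N])
  finally show "N ((1 - t) *\<^sub>R x + t *\<^sub>R y) \<le> (1 - t) * N x + t * N y" .
qed simp

lemma is_norm_continuous_on:
  fixes N :: "'a::euclidean_space \<Rightarrow> real"
  shows "is_norm N \<Longrightarrow> continuous_on UNIV N"
  by (simp add: convex_on_continuous is_norm_convex_on)

lemma is_norm_convex_ball:
  assumes N: "is_norm N"
  shows "convex {x. N x \<le> c}"
proof (rule convexI)
  fix x y and s t :: real
  assume *: "x \<in> {x. N x \<le> c}" "y \<in> {x. N x \<le> c}" "0 \<le> s" "0 \<le> t" "s + t = 1"
  have "N (s *\<^sub>R x + t *\<^sub>R y) \<le> N (s *\<^sub>R x) + N (t *\<^sub>R y)"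
    by (rule is_norm_triangle[OF N])
  also have "\<dots> = s * N x + t * N y"
    using * by (simp add: is_norm_scaleR[OF N])
  also have "\<dots> \<le> c"
    using * by (intro convex_bound_le) auto
  finally show "s *\<^sub>R x + t *\<^sub>R y \<in> {x. N x \<le> c}" by simp
qed

lemma is_norm_closed_ball:
  fixes N :: "'a::euclidean_space \<Rightarrow> real"
  shows "is_norm N \<Longrightarrow> closed {x. N x \<le> c}"
  by (intro closed_Collect_le is_norm_continuous_on continuous_on_const)

text \<open>A norm is bounded below by a positive constant on the compact Euclidean unit sphere.\<close>

lemma is_norm_bounded_ball:
  fixes N :: "'a::euclidean_space \<Rightarrow> real"
  assumes N: "is_norm N"
  shows "bounded {x. N x \<le> c}"
proof -
  have "sphere (0::'a) 1 \<noteq> {}" by simp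
  moreover have "continuous_on (sphere 0 1) N"
    using is_norm_continuous_on[OF N] continuous_on_subset by blast
  ultimately obtain u where u: "u \<in> sphere 0 1" and le: "\<And>v. v \<in> sphere 0 1 \<Longrightarrow> N u \<le> N v"
    using continuous_attains_inf[of "sphere (0::'a) 1" N] by auto
  have pos: "0 < N u"
    using u by (intro is_norm_pos[OF N]) auto
  have "norm x \<le> c / N u" if "N x \<le> c" for x
  proof (cases "x = 0")
    case True
    then show ?thesis using that pos is_norm_0[OF N] by simp
  next
    case False
    have "N u \<le> N ((1 / norm x) *\<^sub>R x)" by (rule le) (use False in simp)
    also have "\<dots> = N x / norm x" by (simp add: is_norm_scaleR[OF N])
    finally have "N u * norm x \<le> N x" using False by (simp add: field_simps)
    with that pos show ?thesis by (simp add: field_simps)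
  qed
  then show ?thesis unfolding bounded_iff by blast
qed

lemma is_norm_compact_ball:
  fixes N :: "'a::euclidean_space \<Rightarrow> real"
  shows "is_norm N \<Longrightarrow> compact {x. N x \<le> c}"
  by (simp add: compact_eq_bounded_closed is_norm_bounded_ball is_norm_closed_ball)

lemma dual_norm_le_iff:
  fixes N :: "'a::euclidean_space \<Rightarrow> real"
  assumes N: "is_norm N"
  shows "dual_norm N y \<le> c \<longleftrightarrow> (\<forall>x. N x \<le> 1 \<longrightarrow> x \<bullet> y \<le> c)"
proof -
  have "bounded ((\<lambda>x. x \<bullet> y) ` {x. N x \<le> 1})"
    by (intro bounded_linear_image is_norm_bounded_ball N bounded_linear_inner_left)
  then have "bdd_above ((\<lambda>x. x \<bullet> y) ` {x. N x \<le> 1})" by (rule bounded_imp_bdd_above)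
  moreover have "{x. N x \<le> 1} \<noteq> {}" using is_norm_0[OF N] by (auto intro!: exI[of _ 0])
  ultimately show ?thesis unfolding dual_norm_def by (subst cSUP_le_iff) auto
qed

lemma inner_le_norm_dual_norm:
  fixes N :: "'a::euclidean_space \<Rightarrow> real"
  assumes N: "is_norm N"
  shows "x \<bullet> y \<le> N x * dual_norm N y"
proof (cases "x = 0")
  case True
  then show ?thesis by (simp add: is_norm_0[OF N])
next
  case False
  have "(1 / N x) *\<^sub>R x \<bullet> y \<le> dual_norm N y"
    using dual_norm_le_iff[OF N, of y "dual_norm N y"] is_norm_normalize[OF N False]
    by (metis order_refl)
  then show ?thesis using is_norm_pos[OF N False] by (simp add: field_simps)
qed

lemma is_norm_dual_norm:
  fixes N :: "'a::euclidean_space \<Rightarrow> real"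
  assumes N: "is_norm N"
  shows "is_norm (dual_norm N)"
proof -
  have inner_le: "x \<bullet> y \<le> dual_norm N y" if "N x \<le> 1" for x y
    using dual_norm_le_iff[OF N, of y "dual_norm N y"] that by simp
  have nonneg: "0 \<le> dual_norm N y" for y
    using inner_le[of 0 y] by (simp add: is_norm_0[OF N])
  have zero: "dual_norm N 0 = 0"
    using nonneg[of 0] dual_norm_le_iff[OF N, of 0 0] by simp
  have pos: "0 < dual_norm N y" if "y \<noteq> 0" for y
  proof -
    have "0 < y \<bullet> y" using that by simp
    also have "\<dots> \<le> N y * dual_norm N y" by (rule inner_le_norm_dual_norm[OF N])
    finally show ?thesis using is_norm_pos[OF N that] by (simp add: zero_less_mult_iff)
  qed
  have scale_le: "dual_norm N (c *\<^sub>R y) \<le> \<bar>c\<bar> * dual_norm N y" for c y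
    unfolding dual_norm_le_iff[OF N]
  proof (intro allI impI)
    fix x assume x: "N x \<le> 1"
    have "x \<bullet> c *\<^sub>R y = (c *\<^sub>R x) \<bullet> y" by simp
    also have "\<dots> \<le> \<bar>c\<bar> * N x * dual_norm N y"
      using inner_le_norm_dual_norm[OF N, of "c *\<^sub>R x" y] by (simp only: is_norm_scaleR[OF N])
    also have "\<dots> \<le> \<bar>c\<bar> * 1 * dual_norm N y"
      by (intro mult_right_mono mult_left_mono x nonneg) simp
    finally show "x \<bullet> c *\<^sub>R y \<le> \<bar>c\<bar> * dual_norm N y" by simp
  qed
  \<comment> \<open>The reverse inequality is the same one applied to the scalar \<open>1 / c\<close>.\<close>
  have scale: "dual_norm N (c *\<^sub>R y) = \<bar>c\<bar> * dual_norm N y" for c y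
  proof (cases "c = 0")
    case True
    then show ?thesis by (simp add: zero)
  next
    case False
    have "dual_norm N y \<le> \<bar>1 / c\<bar> * dual_norm N (c *\<^sub>R y)"
      using scale_le[of "1 / c" "c *\<^sub>R y"] False by simp
    then have "\<bar>c\<bar> * dual_norm N y \<le> dual_norm N (c *\<^sub>R y)"
      using False by (simp add: field_simps)
    with scale_le[of c y] show ?thesis by simp
  qed
  have triangle: "dual_norm N (y + z) \<le> dual_norm N y + dual_norm N z" for y z
    unfolding dual_norm_le_iff[OF N] by (auto simp: inner_add_right intro: add_mono inner_le)
  show ?thesis
    unfolding is_norm_def using nonneg zero pos scale triangle by (metis less_irrefl)
qed

text \<open>
  This is the nontrivial half of \<open>N\<^sub>\<star>\<^sub>\<star> = N\<close>: if \<open>N x > c\<close>, a hyperplane separates \<open>x\<close> from the closed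
  convex ball of radius \<open>c\<close>, and its normal, rescaled to have dual norm at most 1, pairs with \<open>x\<close> to
  more than \<open>c\<close>.
\<close>

lemma norm_le_if_inner_dual_ball_le:
  fixes N :: "'a::euclidean_space \<Rightarrow> real"
  assumes N: "is_norm N" and c: "0 < c"
    and le: "\<And>z. dual_norm N z \<le> 1 \<Longrightarrow> x \<bullet> z \<le> c"
  shows "N x \<le> c"
proof (rule ccontr)
  assume "\<not> N x \<le> c"
  then obtain a b where ab: "a \<bullet> x < b" "\<And>w. N w \<le> c \<Longrightarrow> b < a \<bullet> w"
    using separating_hyperplane_closed_point[of "{w. N w \<le> c}" x]
      is_norm_convex_ball[OF N] is_norm_closed_ball[OF N] by auto
  have b: "b < 0" using ab(2)[of 0] c by (simp add: is_norm_0[OF N])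
  define z where "z = (c / b) *\<^sub>R a"
  have "dual_norm N z \<le> 1"
    unfolding dual_norm_le_iff[OF N]
  proof (intro allI impI)
    fix w assume "N w \<le> 1"
    then have "N (c *\<^sub>R w) \<le> c" using c by (simp add: is_norm_scaleR[OF N])
    from ab(2)[OF this] show "w \<bullet> z \<le> 1"
      using b by (simp add: z_def inner_commute field_simps)
  qed
  from le[OF this] have "c * (a \<bullet> x) \<ge> c * b"
    using b by (simp add: z_def inner_commute field_simps)
  then show False using ab(1) c by simp
qed

section \<open>Coordinate projections and top norms\<close>

lemma linear_restrict_vec: "linear (\<lambda>x. restrict_vec x K)"
  by (intro linearI) (auto simp: restrict_vec_def vec_eq_iff)

lemma restrict_vec_UNIV: "restrict_vec x UNIV = x"
  by (simp add: restrict_vec_def vec_eq_iff)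

lemma inner_restrict_vec_commute: "restrict_vec x K \<bullet> y = x \<bullet> restrict_vec y K"
  by (auto simp: inner_vec_def restrict_vec_def intro!: sum.cong)

lemma restrict_vec_support: "restrict_vec x {i. x $ i \<noteq> 0} = x"
  by (auto simp: restrict_vec_def vec_eq_iff)

lemma l0_restrict_vec_le: "l0 (restrict_vec x K) \<le> card K"
  unfolding l0_def by (rule card_mono) (auto simp: restrict_vec_def split: if_splits)

lemma l0_scaleR: "c \<noteq> 0 \<Longrightarrow> l0 (c *\<^sub>R x) = l0 x"
  by (simp add: l0_def)

lemma l0_eq_0_iff: "l0 x = 0 \<longleftrightarrow> x = 0"
  by (simp add: l0_def vec_eq_iff)

lemma top_norm_le_iff:
  "top_norm N k x \<le> c \<longleftrightarrow> (\<forall>K. card K \<le> k \<longrightarrow> N (restrict_vec x K) \<le> c)"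
proof -
  have "{K :: 'a set. card K \<le> k} \<noteq> {}" by (auto intro!: exI[of _ "{}"])
  then show ?thesis
    unfolding top_norm_def by (subst cSUP_le_iff) (auto intro: bdd_above_finite)
qed

lemma restrict_vec_le_top_norm: "card K \<le> k \<Longrightarrow> N (restrict_vec x K) \<le> top_norm N k x"
  using top_norm_le_iff[of N k x "top_norm N k x"] by simp

lemma top_norm_mono: "k \<le> l \<Longrightarrow> top_norm N k x \<le> top_norm N l x"
  by (auto simp: top_norm_le_iff intro: restrict_vec_le_top_norm)

text \<open>The condition \<open>1 \<le> k\<close> makes all singletons available, which is what definiteness needs.\<close>

lemma is_norm_top_norm:
  fixes N :: "real ^ 'n \<Rightarrow> real"
  assumes N: "is_norm N" and k: "1 \<le> k"
  shows "is_norm (top_norm N k)"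
proof -
  let ?T = "top_norm N k"
  note scale_vec = linear_scale[OF linear_restrict_vec]
  have nonneg: "0 \<le> ?T x" for x
    using restrict_vec_le_top_norm[of "{}" k N x] is_norm_nonneg[OF N, of "restrict_vec x {}"] by simp
  have zero: "?T 0 = 0"
  proof (rule antisym)
    show "?T 0 \<le> 0"
      by (simp add: top_norm_le_iff linear_0[OF linear_restrict_vec] is_norm_0[OF N])
  qed (rule nonneg)
  have definite: "x = 0" if "?T x = 0" for x
  proof (rule ccontr)
    assume "x \<noteq> 0"
    then obtain i where i: "x $ i \<noteq> 0" by (auto simp: vec_eq_iff)
    have "restrict_vec x {i} \<noteq> 0" using i by (auto simp: restrict_vec_def vec_eq_iff)
    then have "0 < N (restrict_vec x {i})" by (rule is_norm_pos[OF N])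
    also have "\<dots> \<le> ?T x" using k by (intro restrict_vec_le_top_norm) simp
    finally show False using that by simp
  qed
  have scale_le: "?T (c *\<^sub>R x) \<le> \<bar>c\<bar> * ?T x" for c x
    by (auto simp: top_norm_le_iff scale_vec is_norm_scaleR[OF N]
        intro!: mult_left_mono restrict_vec_le_top_norm)
  have scale: "?T (c *\<^sub>R x) = \<bar>c\<bar> * ?T x" for c x
  proof (cases "c = 0")
    case True
    then show ?thesis by (simp add: zero)
  next
    case False
    have "?T x \<le> \<bar>1 / c\<bar> * ?T (c *\<^sub>R x)"
      using scale_le[of "1 / c" "c *\<^sub>R x"] False by simp
    then have "\<bar>c\<bar> * ?T x \<le> ?T (c *\<^sub>R x)" using False by (simp add: field_simps)
    with scale_le[of c x] show ?thesis by simp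
  qed
  have triangle: "?T (x + y) \<le> ?T x + ?T y" for x y
    unfolding top_norm_le_iff linear_add[OF linear_restrict_vec]
    by (auto intro!: order_trans[OF is_norm_triangle[OF N]] add_mono restrict_vec_le_top_norm)
  show ?thesis
    unfolding is_norm_def using nonneg zero definite scale triangle by blast
qed

section \<open>Support norms\<close>

lemma is_norm_support_norm:
  fixes N :: "real ^ 'n \<Rightarrow> real"
  shows "is_norm N \<Longrightarrow> 1 \<le> k \<Longrightarrow> is_norm (support_norm N k)"
  unfolding support_norm_def by (intro is_norm_dual_norm is_norm_top_norm)

lemma support_norm_antimono:
  fixes N :: "real ^ 'n \<Rightarrow> real"
  assumes N: "is_norm N" and k: "1 \<le> k" and kl: "k \<le> l"
  shows "support_norm N l y \<le> support_norm N k y"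
proof -
  have T: "is_norm (top_norm N k)" "is_norm (top_norm N l)"
    using is_norm_top_norm[OF N] k kl by auto
  show ?thesis
    unfolding support_norm_def dual_norm_le_iff[OF T(2)]
  proof (intro allI impI)
    fix x assume "top_norm N l x \<le> 1"
    then have "top_norm N k x \<le> 1" using top_norm_mono[OF kl, of N x] by linarith
    then show "x \<bullet> y \<le> dual_norm (top_norm N k) y"
      using dual_norm_le_iff[OF T(1), of y "dual_norm (top_norm N k) y"] by simp
  qed
qed

lemma nonincreasing_norms_support_norm:
  fixes N :: "real ^ 'n \<Rightarrow> real"
  shows "is_norm N \<Longrightarrow> nonincreasing_norms (support_norm N)"
  by (auto simp: nonincreasing_norms_def monotone_on_def
      intro: is_norm_support_norm support_norm_antimono)

text \<open>
  For a covector \<open>a\<close>, being at most \<open>c\<close> on all the generators means \<open>a\<^sub>K \<bullet> z \<le> c\<close> for all \<open>z\<close> of the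
  dual ball, that is, \<open>N (a\<^sub>K) \<le> c\<close> for all \<open>K\<close>, that is, \<open>a\<close> has top norm at most \<open>c\<close>. So a hyperplane
  that separates \<open>y\<close> from the hull yields a point of the top-norm ball whose pairing with \<open>y\<close> exceeds
  1.
\<close>

lemma support_norm_ball_subset_hull:
  fixes N :: "real ^ 'n \<Rightarrow> real"
  assumes N: "is_norm N" and l: "1 \<le> l" and y: "support_norm N l y \<le> 1"
  shows "y \<in> convex hull (\<Union>K\<in>{K. card K \<le> l}. (\<lambda>z. restrict_vec z K) ` {z. dual_norm N z \<le> 1})"
    (is "y \<in> convex hull ?A")
proof (rule ccontr)
  assume "y \<notin> convex hull ?A"
  have T: "is_norm (top_norm N l)" by (rule is_norm_top_norm[OF N l])
  have in_A: "restrict_vec z K \<in> ?A" if "card K \<le> l" "dual_norm N z \<le> 1" for z K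
    using that by blast
  have "compact ?A"
    by (intro compact_UN compact_continuous_image linear_continuous_on
        linear_linear[THEN iffD2] linear_restrict_vec is_norm_compact_ball is_norm_dual_norm N)
      simp
  then have "closed (convex hull ?A)" by (intro compact_imp_closed compact_convex_hull)
  with \<open>y \<notin> convex hull ?A\<close> obtain a b where
    ab: "a \<bullet> y < b" "\<And>x. x \<in> convex hull ?A \<Longrightarrow> b < a \<bullet> x"
    using separating_hyperplane_closed_point[of "convex hull ?A" y] convex_convex_hull by blast
  have A: "b < a \<bullet> restrict_vec z K" if "card K \<le> l" "dual_norm N z \<le> 1" for z K
    using ab(2) hull_inc[OF in_A[OF that]] by blast
  have b: "b < 0"
    using A[of "{}" 0]
    by (simp add: is_norm_0[OF is_norm_dual_norm[OF N]] linear_0[OF linear_restrict_vec])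
  have "top_norm N l (- a) \<le> - b"
    unfolding top_norm_le_iff
  proof (intro allI impI)
    fix K :: "'n set" assume K: "card K \<le> l"
    show "N (restrict_vec (- a) K) \<le> - b"
    proof (rule norm_le_if_inner_dual_ball_le[OF N])
      show "restrict_vec (- a) K \<bullet> z \<le> - b" if "dual_norm N z \<le> 1" for z
        using A[OF K that] by (simp add: inner_restrict_vec_commute)
    qed (use b in simp)
  qed
  then have "top_norm N l ((1 / - b) *\<^sub>R (- a)) \<le> 1"
    unfolding is_norm_scaleR[OF T] using b by (simp add: field_simps)
  then have "(1 / - b) *\<^sub>R (- a) \<bullet> y \<le> 1"
    using y unfolding support_norm_def dual_norm_le_iff[OF T] by blast
  then show False using ab(1) b by (simp add: field_simps)
qed

section \<open>Orthant-monotonic source norms\<close>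

lemma orthant_monotonic_restrict_vec_le:
  "orthant_monotonic N \<Longrightarrow> N (restrict_vec x K) \<le> N x"
  unfolding orthant_monotonic_def
  by (erule allE[of _ "restrict_vec x K"], erule allE[of _ x]) (auto simp: restrict_vec_def)

lemma dual_norm_restrict_vec_le:
  fixes N :: "real ^ 'n \<Rightarrow> real"
  assumes N: "is_norm N" and om: "orthant_monotonic N"
  shows "dual_norm N (restrict_vec z K) \<le> dual_norm N z"
  unfolding dual_norm_le_iff[OF N]
proof (intro allI impI)
  fix x assume x: "N x \<le> 1"
  have "N (restrict_vec x K) \<le> 1"
    using orthant_monotonic_restrict_vec_le[OF om, of x K] x by linarith
  then have "restrict_vec x K \<bullet> z \<le> dual_norm N z"
    using dual_norm_le_iff[OF N, of z "dual_norm N z"] by simp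
  then show "x \<bullet> restrict_vec z K \<le> dual_norm N z"
    by (simp add: inner_restrict_vec_commute)
qed

lemma top_norm_CARD:
  fixes N :: "real ^ 'n \<Rightarrow> real"
  assumes "orthant_monotonic N"
  shows "top_norm N CARD('n) = N"
proof
  fix x
  have "top_norm N CARD('n) x \<le> N x"
    by (simp add: top_norm_le_iff orthant_monotonic_restrict_vec_le[OF assms])
  moreover have "N x \<le> top_norm N CARD('n) x"
    using restrict_vec_le_top_norm[of UNIV "CARD('n)" N x] by (simp add: restrict_vec_UNIV)
  ultimately show "top_norm N CARD('n) x = N x" by simp
qed

lemma support_norm_CARD:
  fixes N :: "real ^ 'n \<Rightarrow> real"
  shows "orthant_monotonic N \<Longrightarrow> support_norm N CARD('n) = dual_norm N"
  by (simp add: support_norm_def top_norm_CARD)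

text \<open>
  Replacing \<open>x\<close> by its projection on the support of \<open>y\<close> changes neither \<open>x \<bullet> y\<close> nor the admissibility
  of \<open>x\<close>, and turns a bound on the top norm of \<open>x\<close> into a bound on the source norm.
\<close>

lemma support_norm_eq_dual_norm:
  fixes N :: "real ^ 'n \<Rightarrow> real"
  assumes N: "is_norm N" and om: "orthant_monotonic N"
    and l: "l \<in> {1..CARD('n)}" and y: "l0 y \<le> l"
  shows "support_norm N l y = dual_norm N y"
proof (rule antisym)
  let ?K = "{i. y $ i \<noteq> 0}"
  have T: "is_norm (top_norm N l)" using is_norm_top_norm[OF N] l by simp
  show "support_norm N l y \<le> dual_norm N y"
    unfolding support_norm_def dual_norm_le_iff[OF T]
  proof (intro allI impI)
    fix x assume x: "top_norm N l x \<le> 1"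
    have "N (restrict_vec x ?K) \<le> 1"
      using x y unfolding top_norm_le_iff l0_def by blast
    then have "restrict_vec x ?K \<bullet> y \<le> dual_norm N y"
      using dual_norm_le_iff[OF N, of y "dual_norm N y"] by simp
    then show "x \<bullet> y \<le> dual_norm N y"
      by (simp add: inner_restrict_vec_commute restrict_vec_support)
  qed
  show "dual_norm N y \<le> support_norm N l y"
    using support_norm_antimono[OF N, of l "CARD('n)" y] l support_norm_CARD[OF om] by simp
qed

lemma l0_le_if_support_norm_eq_dual_norm:
  fixes N :: "real ^ 'n \<Rightarrow> real"
  assumes N: "is_norm N" and om: "orthant_monotonic N"
    and sc: "strictly_convex_norm (dual_norm N)"
    and l: "1 \<le> l" and eq: "support_norm N l y = dual_norm N y"
  shows "l0 y \<le> l"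
proof (cases "y = 0")
  case True
  then show ?thesis by (simp add: l0_eq_0_iff[THEN iffD2])
next
  case False
  let ?B = "{z. dual_norm N z \<le> 1}"
  let ?A = "\<Union>K\<in>{K. card K \<le> l}. (\<lambda>z. restrict_vec z K) ` ?B"
  have D: "is_norm (dual_norm N)" by (rule is_norm_dual_norm[OF N])
  define u where "u = (1 / dual_norm N y) *\<^sub>R y"
  have u: "dual_norm N u = 1" unfolding u_def by (rule is_norm_normalize[OF D False])
  have "support_norm N l u = 1"
    using eq is_norm_pos[OF D False]
    by (simp add: u_def is_norm_scaleR[OF is_norm_support_norm[OF N l]])
  then have "u \<in> convex hull ?A"
    using support_norm_ball_subset_hull[OF N l] by simp
  moreover have "convex hull ?A \<subseteq> ?B"
    using dual_norm_restrict_vec_le[OF N om]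
    by (intro hull_minimal is_norm_convex_ball[OF D]) (fastforce intro: order_trans)
  moreover have "u extreme_point_of ?B"
    using sc u by (simp add: strictly_convex_norm_def)
  ultimately have "u extreme_point_of (convex hull ?A)"
    unfolding extreme_point_of_def by blast
  then have "u \<in> ?A" by (rule extreme_point_of_convex_hull)
  then obtain K z where "card K \<le> l" "u = restrict_vec z K" by blast
  then have "l0 u \<le> l" using l0_restrict_vec_le[of z K] by simp
  moreover have "l0 u = l0 y"
    unfolding u_def using is_norm_pos[OF D False] by (intro l0_scaleR) simp
  ultimately show ?thesis by simp
qed

lemma ext_support_norm_0_eq_iff:
  fixes N :: "real ^ 'n \<Rightarrow> real"
  assumes "is_norm N"
  shows "ext_support_norm N 0 y = ext_support_norm N CARD('n) y \<longleftrightarrow> y = 0"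
proof -
  have "is_norm (support_norm N CARD('n))"
    using assms by (intro is_norm_support_norm) (simp_all add: Suc_leI)
  then show ?thesis by (auto simp: ext_support_norm_def is_norm_0)
qed

theorem proposition20:
  fixes N :: "real ^ 'n \<Rightarrow> real"
  assumes "is_norm N"
  shows "(orthant_monotonic N \<longrightarrow>
            decreasingly_graded (support_norm N) \<and>
            (\<forall>y. \<forall>l\<in>{0..CARD('n)}. l0 y \<le> l \<longrightarrow>
               ext_support_norm N l y = ext_support_norm N CARD('n) y)) \<and>
         (orthant_monotonic N \<and> strictly_convex_norm (dual_norm N) \<longrightarrow>
            strictly_decreasingly_graded (support_norm N) \<and>
            (\<forall>y. \<forall>l\<in>{0..CARD('n)}. l0 y \<le> l \<longleftrightarrow>
               ext_support_norm N l y = ext_support_norm N CARD('n) y))"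
proof (intro conjI impI)
  assume om: "orthant_monotonic N"
  have graded: "support_norm N l y = support_norm N CARD('n) y"
    if "l \<in> {1..CARD('n)}" "l0 y \<le> l" for l y
    using support_norm_eq_dual_norm[OF assms om that] support_norm_CARD[OF om] by simp
  then show "decreasingly_graded (support_norm N)"
    unfolding decreasingly_graded_def using nonincreasing_norms_support_norm[OF assms] by blast
  show "\<forall>y. \<forall>l\<in>{0..CARD('n)}. l0 y \<le> l \<longrightarrow>
          ext_support_norm N l y = ext_support_norm N CARD('n) y"
  proof (intro allI ballI impI)
    fix y :: "real ^ 'n" and l assume l: "l \<in> {0..CARD('n)}" "l0 y \<le> l"
    show "ext_support_norm N l y = ext_support_norm N CARD('n) y"
    proof (cases "l = 0")
      case True
      then show ?thesis
        using l ext_support_norm_0_eq_iff[OF assms] l0_eq_0_iff[of y] by simp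
    next
      case False
      then show ?thesis using l graded[of l y] by (simp add: ext_support_norm_def)
    qed
  qed
next
  assume *: "orthant_monotonic N \<and> strictly_convex_norm (dual_norm N)"
  then have om: "orthant_monotonic N" and sc: "strictly_convex_norm (dual_norm N)" by auto
  have graded: "l0 y \<le> l \<longleftrightarrow> support_norm N l y = support_norm N CARD('n) y"
    if "l \<in> {1..CARD('n)}" for l y
    using support_norm_eq_dual_norm[OF assms om that, of y]
      l0_le_if_support_norm_eq_dual_norm[OF assms om sc, of l y] that support_norm_CARD[OF om]
    by auto
  then show "strictly_decreasingly_graded (support_norm N)"
    unfolding strictly_decreasingly_graded_def
    using nonincreasing_norms_support_norm[OF assms] by blast
  show "\<forall>y. \<forall>l\<in>{0..CARD('n)}. l0 y \<le> l \<longleftrightarrow>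
          ext_support_norm N l y = ext_support_norm N CARD('n) y"
  proof (intro allI ballI)
    fix y :: "real ^ 'n" and l assume l: "l \<in> {0..CARD('n)}"
    show "l0 y \<le> l \<longleftrightarrow> ext_support_norm N l y = ext_support_norm N CARD('n) y"
    proof (cases "l = 0")
      case True
      then show ?thesis
        using ext_support_norm_0_eq_iff[OF assms] l0_eq_0_iff[of y] by simp
    next
      case False
      then show ?thesis using l graded[of l y] by (simp add: ext_support_norm_def)
    qed
  qed
qed

end
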